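(* Let $\Gamma$ be a Matsumoto graph and let $v,v'$ be vertices of $\Gamma$. Then any two shortest paths in $\Gamma$ from $v$ to $v'$ are braid equivalent.
   Context: A ray in a finite-dimensional real vector space $\mathbb{V}$ is a closed half-line $\mathbb{R}_{\ge 0}x$ with $x\neq 0$; $-\alpha$ denotes the opposite ray of $\alpha$. For rays $\alpha_1,\dots,\alpha_k$, $C(\alpha_1,\dots,\alpha_k)$ is the convex cone they generate. Rays are called linearly independent, resp. a basis, if nonzero representatives are. Graphs $\Gamma=(V,E)$ are nonempty and connected, with $E=E_c\sqcup E_\infty$: a compact edge $e\in E_c$ has two ends; an infinite edge $e\in E_\infty$ is attached to only one vertex. Each compact edge has two orientations $(e,1),(e,-1)$, opposite to each other; each infinite edge has a single orientation $(e,1)$ and is regarded as ingoing to its vertex. We write $(e,\epsilon):v\to v'$ for a compact oriented edge from $v$ to $v'$ (it is ingoing to $v'$). Paths are sequences of composable oriented compact edges; the length of a path is the number of its edges, and a shortest path from $v$ to $v'$ is a path of minimal length from $v$ to $v'$. A geometric realization of $\Gamma$ (in $\mathbb{V}$) assigns a ray $\alpha_{e,\epsilon}\subset\mathbb{V}$ to each oriented edge, with $\alpha_{e,-\epsilon}=-\alpha_{e,\epsilon}$ for $e\in E_c$ (write $\alpha_e=\alpha_{e,1}$ for $e\in E_\infty$), such that, with $R$ the set of all assigned rays ("roots"): (1) if $e\in E_\infty$ then $-\alpha_e\notin R$; (2) for each vertex $v$ the roots $\alpha_1,\dots,\alpha_d$ assigned to the oriented edges ingoing to $v$ (one per edge at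 $v$) form a basis of $\mathbb{V}$, called the basis at $v$ (so $\Gamma$ is regular of degree $d=\dim\mathbb{V}$); put $R^+_v=\{\alpha\in R: \alpha\subset C(\alpha_1,\dots,\alpha_d)\}$; (3) for each compact oriented edge $(e,\epsilon):v\to v'$ one has $R^+_{v'}\setminus R^+_v=\{\alpha_{e,\epsilon}\}$; (4) if $R^+_v=R^+_{v'}$ then $v=v'$. A Matsumoto graph is a connected graph endowed with a geometric realization. Rank two subgraphs: for a vertex $v$ and two distinct roots $\alpha,\beta$ of the basis at $v$, let $\mathbb{W}=\mathrm{Span}_{\mathbb{R}}(\alpha,\beta)$ and let $\Gamma(v,\alpha,\beta)$ be the connected component of $v$ in the subgraph of $\Gamma$ having all vertices of $\Gamma$ and those edges $e\in E$ with $\alpha_{e,1}\subset\mathbb{W}$. It is a connected graph regular of degree 2. We say it is a $2m$-gon if it is a finite cycle with $2m$ (compact) edges and no infinite edges. Braid equivalence is the minimal equivalence relation on the set of paths of $\Gamma$ such that: (i) whenever $\Gamma(v,\alpha,\beta)$ is a $2m$-gon, the two paths of length $m$ in it that start at $v$, go around the polygon in the two opposite directions, and end at the vertex opposite to $v$, are equivalent; (ii) the relation is closed under concatenation of paths. *)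

theory Defs
  imports "HOL-Analysis.Analysis"
begin

section \<open>Rays\<close>

text \<open>
  The ambient space is an arbitrary type of class \<^class>\<open>real_vector\<close>; finite dimension is an
  explicit assumption below, so that dimension zero is not excluded. Rays are sets of vectors.
\<close>

definition is_ray :: "'a::real_vector set \<Rightarrow> bool" where
  "is_ray r \<longleftrightarrow> (\<exists>x. x \<noteq> 0 \<and> r = {t *\<^sub>R x | t. 0 \<le> t})"

abbreviation opposite_ray :: "'a::real_vector set \<Rightarrow> 'a set" where
  "opposite_ray r \<equiv> uminus ` r"

abbreviation ray_cone :: "'a::real_vector set set \<Rightarrow> 'a set" where
  "ray_cone S \<equiv> convex_cone hull (\<Union>S)"

text \<open>A family of rays is a basis if nonzero representatives form a basis (as a family).\<close>

definition rays_basis :: "'i set \<Rightarrow> ('i \<Rightarrow> 'a::real_vector set) \<Rightarrow> bool" where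
  "rays_basis I r \<longleftrightarrow>
     (\<exists>x. (\<forall>i\<in>I. x i \<in> r i \<and> x i \<noteq> 0) \<and> inj_on x I \<and> independent (x ` I) \<and> span (x ` I) = UNIV)"

section \<open>Graphs with compact and infinite edges\<close>

text \<open>
  An oriented edge is a pair of an edge and a sign, \<^term>\<open>True\<close> standing for the orientation $1$
  and \<^term>\<open>False\<close> for $-1$. A compact edge with sign \<^term>\<open>True\<close> goes from its tail to its
  head. An infinite edge is attached to its head, and its tail is irrelevant.
\<close>

record ('v, 'e) graph =
  verts :: "'v set"
  cedges :: "'e set"
  iedges :: "'e set"
  tail :: "'e \<Rightarrow> 'v"
  head :: "'e \<Rightarrow> 'v"

type_synonym 'e oedge = "'e \<times> bool"

definition osrc :: "('v, 'e) graph \<Rightarrow> 'e oedge \<Rightarrow> 'v" where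
  "osrc G a = (if snd a then tail G (fst a) else head G (fst a))"

definition otgt :: "('v, 'e) graph \<Rightarrow> 'e oedge \<Rightarrow> 'v" where
  "otgt G a = (if snd a then head G (fst a) else tail G (fst a))"

definition flip :: "'e oedge \<Rightarrow> 'e oedge" where
  "flip a = (fst a, \<not> snd a)"

definition compact_oedges :: "('v, 'e) graph \<Rightarrow> 'e oedge set" where
  "compact_oedges G = cedges G \<times> UNIV"

definition oedges :: "('v, 'e) graph \<Rightarrow> 'e oedge set" where
  "oedges G = compact_oedges G \<union> iedges G \<times> {True}"

definition ingoing :: "('v, 'e) graph \<Rightarrow> 'v \<Rightarrow> 'e oedge set" where
  "ingoing G v = {a \<in> oedges G. otgt G a = v}"

text \<open>\<open>walk G u p w\<close>: the sequence \<open>p\<close> of compact oriented edges is a path from \<open>u\<close> to \<open>w\<close>.\<close>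

fun walk :: "('v, 'e) graph \<Rightarrow> 'v \<Rightarrow> 'e oedge list \<Rightarrow> 'v \<Rightarrow> bool" where
  "walk G u [] w \<longleftrightarrow> u \<in> verts G \<and> u = w"
| "walk G u (a # p) w \<longleftrightarrow>
     u \<in> verts G \<and> a \<in> compact_oedges G \<and> osrc G a = u \<and> walk G (otgt G a) p w"

definition shortest_path :: "('v, 'e) graph \<Rightarrow> 'v \<Rightarrow> 'e oedge list \<Rightarrow> 'v \<Rightarrow> bool" where
  "shortest_path G u p w \<longleftrightarrow> walk G u p w \<and> (\<forall>q. walk G u q w \<longrightarrow> length p \<le> length q)"

definition reverse_path :: "'e oedge list \<Rightarrow> 'e oedge list" where
  "reverse_path p = rev (map flip p)"

locale connected_graph =
  fixes G :: "('v, 'e) graph"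
  assumes verts_nonempty: "verts G \<noteq> {}"
    and edges_disjoint: "cedges G \<inter> iedges G = {}"
    and cedge_ends: "e \<in> cedges G \<Longrightarrow> tail G e \<in> verts G \<and> head G e \<in> verts G"
    and iedge_end: "e \<in> iedges G \<Longrightarrow> head G e \<in> verts G"
    and connected: "u \<in> verts G \<Longrightarrow> w \<in> verts G \<Longrightarrow> \<exists>p. walk G u p w"

section \<open>Matsumoto graphs\<close>

definition roots :: "('v, 'e) graph \<Rightarrow> ('e oedge \<Rightarrow> 'a::real_vector set) \<Rightarrow> 'a set set" where
  "roots G \<rho> = \<rho> ` oedges G"

definition basis_at :: "('v, 'e) graph \<Rightarrow> ('e oedge \<Rightarrow> 'a::real_vector set) \<Rightarrow> 'v \<Rightarrow> 'a set set" where
  "basis_at G \<rho> v = \<rho> ` ingoing G v"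

definition pos_roots :: "('v, 'e) graph \<Rightarrow> ('e oedge \<Rightarrow> 'a::real_vector set) \<Rightarrow> 'v \<Rightarrow> 'a set set" where
  "pos_roots G \<rho> v = {\<alpha> \<in> roots G \<rho>. \<alpha> \<subseteq> ray_cone (basis_at G \<rho> v)}"

locale matsumoto_graph = connected_graph G
  for G :: "('v, 'e) graph" +
  fixes \<rho> :: "'e oedge \<Rightarrow> 'a::real_vector set"
  assumes finite_dim: "\<exists>B :: 'a set. finite B \<and> span B = UNIV"
    and root_is_ray: "a \<in> oedges G \<Longrightarrow> is_ray (\<rho> a)"
    and root_flip: "a \<in> compact_oedges G \<Longrightarrow> \<rho> (flip a) = opposite_ray (\<rho> a)"
    and opposite_infinite: "e \<in> iedges G \<Longrightarrow> opposite_ray (\<rho> (e, True)) \<notin> roots G \<rho>"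
    and basis_ingoing: "v \<in> verts G \<Longrightarrow> rays_basis (ingoing G v) \<rho>"
    and pos_roots_step: "a \<in> compact_oedges G \<Longrightarrow>
          pos_roots G \<rho> (otgt G a) - pos_roots G \<rho> (osrc G a) = {\<rho> a}"
    and pos_roots_inj: "v \<in> verts G \<Longrightarrow> w \<in> verts G \<Longrightarrow>
          pos_roots G \<rho> v = pos_roots G \<rho> w \<Longrightarrow> v = w"

section \<open>Rank two subgraphs and polygons\<close>

definition component :: "('v, 'e) graph \<Rightarrow> 'v \<Rightarrow> ('v, 'e) graph" where
  "component H v = (let C = {w. \<exists>p. walk H v p w} in
     H\<lparr>verts := C, cedges := {e \<in> cedges H. head H e \<in> C}, iedges := {e \<in> iedges H. head H e \<in> C}\<rparr>)"

definition rank_two_subgraph ::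
  "('v, 'e) graph \<Rightarrow> ('e oedge \<Rightarrow> 'a::real_vector set) \<Rightarrow> 'v \<Rightarrow> 'a set \<Rightarrow> 'a set \<Rightarrow> ('v, 'e) graph" where
  "rank_two_subgraph G \<rho> v \<alpha> \<beta> = (let W = span (\<alpha> \<union> \<beta>) in
     component
       (G\<lparr>cedges := {e \<in> cedges G. \<rho> (e, True) \<subseteq> W}, iedges := {e \<in> iedges G. \<rho> (e, True) \<subseteq> W}\<rparr>) v)"

text \<open>
  \<open>full_circuit H u c\<close>: the closed path \<open>c\<close> from \<open>u\<close> passes exactly once through every vertex
  and exactly once along every compact edge of \<open>H\<close>.
\<close>

definition full_circuit :: "('v, 'e) graph \<Rightarrow> 'v \<Rightarrow> 'e oedge list \<Rightarrow> bool" where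
  "full_circuit H u c \<longleftrightarrow> walk H u c u \<and>
     distinct (map (osrc H) c) \<and> set (map (osrc H) c) = verts H \<and>
     distinct (map fst c) \<and> set (map fst c) = cedges H"

definition polygon :: "nat \<Rightarrow> ('v, 'e) graph \<Rightarrow> bool" where
  "polygon n H \<longleftrightarrow> iedges H = {} \<and> (\<exists>u c. full_circuit H u c \<and> length c = n)"

section \<open>Braid equivalence\<close>

text \<open>A path is given by its first vertex and its list of edges, so that each vertex has its own empty path.\<close>

type_synonym ('v, 'e) path = "'v \<times> 'e oedge list"

definition path_end :: "('v, 'e) graph \<Rightarrow> ('v, 'e) path \<Rightarrow> 'v" where
  "path_end G P = (if snd P = [] then fst P else otgt G (last (snd P)))"

definition paths :: "('v, 'e) graph \<Rightarrow> ('v, 'e) path set" where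
  "paths G = {P. walk G (fst P) (snd P) (path_end G P)}"

definition concat_path :: "('v, 'e) path \<Rightarrow> ('v, 'e) path \<Rightarrow> ('v, 'e) path" where
  "concat_path P Q = (fst P, snd P @ snd Q)"

text \<open>
  In a \<open>2m\<close>-gon, two paths \<open>p\<close> and \<open>q\<close> of length \<open>m\<close> from \<open>v\<close> go around in opposite directions and
  meet at the opposite vertex precisely when \<open>p\<close> followed by the reverse of \<open>q\<close> is a full circuit.
\<close>

inductive braid_equiv ::
  "('v, 'e) graph \<Rightarrow> ('e oedge \<Rightarrow> 'a::real_vector set) \<Rightarrow> ('v, 'e) path \<Rightarrow> ('v, 'e) path \<Rightarrow> bool"
  for G :: "('v, 'e) graph" and \<rho> :: "'e oedge \<Rightarrow> 'a set" where
  refl: "P \<in> paths G \<Longrightarrow> braid_equiv G \<rho> P P"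
| sym: "braid_equiv G \<rho> P Q \<Longrightarrow> braid_equiv G \<rho> Q P"
| trans: "braid_equiv G \<rho> P Q \<Longrightarrow> braid_equiv G \<rho> Q S \<Longrightarrow> braid_equiv G \<rho> P S"
| polygon: "v \<in> verts G \<Longrightarrow> \<alpha> \<in> basis_at G \<rho> v \<Longrightarrow> \<beta> \<in> basis_at G \<rho> v \<Longrightarrow> \<alpha> \<noteq> \<beta> \<Longrightarrow>
    H = rank_two_subgraph G \<rho> v \<alpha> \<beta> \<Longrightarrow> polygon (2 * m) H \<Longrightarrow>
    length p = m \<Longrightarrow> length q = m \<Longrightarrow> full_circuit H v (p @ reverse_path q) \<Longrightarrow>
    braid_equiv G \<rho> (v, p) (v, q)"
| concat: "braid_equiv G \<rho> P P' \<Longrightarrow> braid_equiv G \<rho> Q Q' \<Longrightarrow>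
    path_end G P = fst Q \<Longrightarrow> path_end G P' = fst Q' \<Longrightarrow>
    braid_equiv G \<rho> (concat_path P Q) (concat_path P' Q')"

end

(*
  Crossing an edge replaces one positive root by its opposite, so the distance from v to w is the
  number of roots that are positive at v but not at w, and a first edge of a shortest path crosses
  such a root. Suppose two shortest paths start with different edges, crossing the basis roots alpha
  and beta. All roots of Span(alpha, beta) that are positive at v lie in the cone of alpha and
  beta, hence are negative at w; so there are finitely many, the rank two subgraph is a polygon, and
  its vertex u opposite to v lies on shortest paths from v to w. Passing through u along the two
  sides of the polygon reduces the claim, by induction on the distance, to pairs of shortest paths
  with the same first edge.
*)
theory Submission
  imports Defs
begin

section \<open>Coordinates with respect to a basis of rays\<close>

text \<open>The difficulty is to see that the rank two subgraph is a polygon, as no group acts on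
  it. The key invariant is that the plane \<open>W\<close> keeps meeting the basis in two roots:
  crossing an edge of \<open>W\<close> preserves this. So every vertex of the component has exactly
  two edges in \<open>W\<close>, and a simple circuit inside \<open>W\<close> already exhausts the
  component. The circuit consists of two walks from v, leaving through alpha and beta, that cross
  only roots of \<open>W\<close> positive at v. While one of these roots is still positive, such a
  walk can go on: otherwise both basis roots in \<open>W\<close> at the current vertex would be
  negative at v, and the cone they span with them. Finiteness makes it stop, and both walks stop at
  the same vertex, since its positive roots are determined: those in \<open>W\<close> have all
  changed sign, the others not at all. They meet nowhere earlier, since before the end only one edge
  in \<open>W\<close> leads back towards v.\<close>

locale ray_coordinates =
  fixes I :: "'i set" and r :: "'i \<Rightarrow> 'a::real_vector set"
    and X :: "'i \<Rightarrow> 'a" and f :: "'i \<Rightarrow> 'a \<Rightarrow> real"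
  assumes finite_index: "finite I"
    and ray_eq: "i \<in> I \<Longrightarrow> r i = {t *\<^sub>R X i | t. 0 \<le> t}"
    and linear_coord: "i \<in> I \<Longrightarrow> linear (f i)"
    and coord_basis: "i \<in> I \<Longrightarrow> j \<in> I \<Longrightarrow> f i (X j) = (if i = j then 1 else 0)"
    and expansion: "y = (\<Sum>i\<in>I. f i y *\<^sub>R X i)"
begin

lemma basis_in_ray: "i \<in> I \<Longrightarrow> X i \<in> r i"
  using ray_eq[of i] by (auto intro: exI[of _ 1])

lemma coord_ray: "i \<in> I \<Longrightarrow> j \<in> I \<Longrightarrow> i \<noteq> j \<Longrightarrow> x \<in> r j \<Longrightarrow> f i x = 0"
  using ray_eq[of j] coord_basis[of i j] linear_scale[OF linear_coord[of i]] by auto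

lemma ray_inj: "i \<in> I \<Longrightarrow> j \<in> I \<Longrightarrow> r i = r j \<Longrightarrow> i = j"
  using coord_ray[of i j "X i"] basis_in_ray[of i] coord_basis[of i i] by fastforce

lemma expansion_on:
  assumes "J \<subseteq> I" "\<forall>i\<in>I - J. f i y = 0"
  shows "y = (\<Sum>i\<in>J. f i y *\<^sub>R X i)"
proof -
  have "(\<Sum>i\<in>I. f i y *\<^sub>R X i) = (\<Sum>i\<in>J. f i y *\<^sub>R X i)"
    using assms finite_index by (intro sum.mono_neutral_right) auto
  then show ?thesis using expansion[of y] by simp
qed

text \<open>As \<open>f\<close> is the family dual to \<open>X\<close>, questions about spans of
  basis roots become questions about which coordinates vanish.\<close>

lemma span_rays:
  assumes "J \<subseteq> I"
  shows "span (\<Union>(r ` J)) = {y. \<forall>i\<in>I - J. f i y = 0}"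
proof
  have "subspace {y. \<forall>i\<in>I - J. f i y = 0}"
    using linear_coord
    by (auto simp: subspace_def linear_0 linear_add linear_scale)
  then show "span (\<Union>(r ` J)) \<subseteq> {y. \<forall>i\<in>I - J. f i y = 0}"
    using assms by (intro span_minimal) (auto, metis coord_ray subsetD)
  show "{y. \<forall>i\<in>I - J. f i y = 0} \<subseteq> span (\<Union>(r ` J))"
  proof
    fix y assume "y \<in> {y. \<forall>i\<in>I - J. f i y = 0}"
    then have "y = (\<Sum>i\<in>J. f i y *\<^sub>R X i)"
      using expansion_on[OF assms, of y] by simp
    also have "\<dots> \<in> span (\<Union>(r ` J))"
      using assms basis_in_ray by (intro span_sum span_scale span_base) auto
    finally show "y \<in> span (\<Union>(r ` J))" .
  qed
qed

lemma cone_rays: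
  assumes "J \<subseteq> I"
  shows "convex_cone hull (\<Union>(r ` J)) = {y. (\<forall>i\<in>J. 0 \<le> f i y) \<and> (\<forall>i\<in>I - J. f i y = 0)}"
    (is "_ = ?C")
proof
  have "convex_cone ?C"
    using linear_coord assms
    by (auto simp: convex_cone_iff linear_0 linear_add linear_scale subset_iff)
  moreover have "x \<in> ?C" if jx: "j \<in> J" "x \<in> r j" for j x
  proof -
    obtain t where t: "0 \<le> t" "x = t *\<^sub>R X j"
      using jx assms ray_eq[of j] by auto
    have "f i x = t * (if i = j then 1 else 0)" if "i \<in> I" for i
      using that \<open>j \<in> J\<close> assms t coord_basis[of i j] linear_scale[OF linear_coord[of i]] by auto
    then show ?thesis using t assms \<open>j \<in> J\<close> by auto
  qed
  ultimately show "convex_cone hull (\<Union>(r ` J)) \<subseteq> ?C"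
    by (intro hull_minimal) auto
  show "?C \<subseteq> convex_cone hull (\<Union>(r ` J))"
  proof
    fix y assume y: "y \<in> ?C"
    \<comment> \<open>The subset \<open>K\<close> varies while the hull stays that of
      \<open>J\<close>, so the induction hypothesis applies unchanged.\<close>
    have "(\<Sum>i\<in>K. f i y *\<^sub>R X i) \<in> convex_cone hull (\<Union>(r ` J))" if "finite K" "K \<subseteq> J" for K
      using that
    proof (induction K)
      case empty
      then show ?case by (simp add: convex_cone_hull_contains_0)
    next
      case (insert k K)
      have "f k y *\<^sub>R X k \<in> convex_cone hull (\<Union>(r ` J))"
        using insert y assms basis_in_ray[of k]
        by (intro convex_cone_hull_mul hull_inc) auto
      then show ?case using insert by (simp add: convex_cone_hull_add)
    qed
    moreover have "finite J" using assms finite_index finite_subset by blast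
    moreover have "y = (\<Sum>i\<in>J. f i y *\<^sub>R X i)" using expansion_on[OF assms, of y] y by simp
    ultimately show "y \<in> convex_cone hull (\<Union>(r ` J))" by (metis order_refl)
  qed
qed

lemma cone_all: "ray_cone (r ` I) = {y. \<forall>i\<in>I. 0 \<le> f i y}"
  using cone_rays[of I] by simp

text \<open>All coordinates of \<open>y\<close> are both nonnegative and nonpositive. This is what
  prevents a root and its opposite from being positive at the same vertex.\<close>

lemma cone_pointed:
  assumes "y \<in> ray_cone (r ` I)" "- y \<in> ray_cone (r ` I)"
  shows "y = 0"
proof -
  have "f i y = 0" if "i \<in> I" for i
    using assms that linear_coord[OF that] by (force simp: cone_all linear_neg)
  then show ?thesis using expansion[of y] by simp
qed

text \<open>A simplicial cone meets the span of some of its generators in the face they generate.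
  With two generators this confines the positive roots of a plane to a planar cone.\<close>

lemma cone_face:
  assumes "J \<subseteq> I"
  shows "ray_cone (r ` I) \<inter> span (\<Union>(r ` J)) \<subseteq> convex_cone hull (\<Union>(r ` J))"
  using assms by (auto simp: cone_all cone_rays span_rays)

end

lemma is_ray_generator:
  assumes "is_ray s" "x \<in> s" "x \<noteq> 0"
  shows "s = {t *\<^sub>R x | t. 0 \<le> t}"
proof -
  obtain z where z: "z \<noteq> 0" "s = {t *\<^sub>R z | t. 0 \<le> t}"
    using assms(1) by (auto simp: is_ray_def)
  obtain c where c: "0 \<le> c" "x = c *\<^sub>R z" using assms(2) z by auto
  with assms(3) have "0 < c" by (cases "c = 0") auto
  show ?thesis
  proof (intro set_eqI iffI)
    fix y assume "y \<in> s"
    then obtain t where "0 \<le> t" "y = t *\<^sub>R z" using z by auto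
    then show "y \<in> {t *\<^sub>R x | t. 0 \<le> t}"
      using c \<open>0 < c\<close> by (auto intro!: exI[of _ "t / c"])
  next
    fix y assume "y \<in> {t *\<^sub>R x | t. 0 \<le> t}"
    then show "y \<in> s" using c z by (auto intro!: mult_nonneg_nonneg)
  qed
qed

text \<open>Finite dimension makes the index set finite; each functional is the linear extension of
  the indicator of one basis vector.\<close>

lemma rays_basis_coordinates:
  fixes r :: "'i \<Rightarrow> 'a::real_vector set"
  assumes "rays_basis I r" and rays: "\<And>i. i \<in> I \<Longrightarrow> is_ray (r i)"
    and "finite (B :: 'a set)" "span B = UNIV"
  shows "\<exists>X f. ray_coordinates I r X f"
proof -
  obtain X where X: "\<forall>i\<in>I. X i \<in> r i \<and> X i \<noteq> 0" "inj_on X I" "independent (X ` I)"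
    "span (X ` I) = UNIV"
    using assms(1) by (auto simp: rays_basis_def)
  have "finite (X ` I)"
    using real_vector.independent_span_bound[OF assms(3) X(3)] assms(4) by simp
  then have fin: "finite I" using X(2) finite_imageD by blast
  have "\<exists>g. linear g \<and> (\<forall>x\<in>X ` I. g x = (if x = X i then 1 else 0 :: real))" for i
    by (rule linear_independent_extend[OF X(3)])
  then obtain f where f: "\<And>i. linear (f i)"
    "\<And>i x. x \<in> X ` I \<Longrightarrow> f i x = (if x = X i then 1 else 0 :: real)"
    by metis
  have dual: "f i (X j) = (if i = j then 1 else 0)" if "i \<in> I" "j \<in> I" for i j
    using f(2)[of "X j" i] that X(2) by (auto simp: inj_on_eq_iff)
  have "y = (\<Sum>i\<in>I. f i y *\<^sub>R X i)" for y
  proof -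
    have lin: "linear (\<lambda>y. \<Sum>i\<in>I. f i y *\<^sub>R X i)"
      by (rule linearI)
        (simp_all add: linear_add[OF f(1)] linear_scale[OF f(1)] scaleR_add_left sum.distrib scaleR_sum_right)
    show ?thesis
    proof (rule linear_eq_on[OF linear_ident lin, of y "X ` I"])
      show "y \<in> span (X ` I)" using X(4) by simp
      fix x assume "x \<in> X ` I"
      then obtain j where j: "j \<in> I" "x = X j" by auto
      have "(\<Sum>i\<in>I. f i x *\<^sub>R X i) = (\<Sum>i\<in>I. if i = j then X i else 0)"
        using j dual by (intro sum.cong) auto
      then show "x = (\<Sum>i\<in>I. f i x *\<^sub>R X i)" using j fin by simp
    qed
  qed
  moreover have "r i = {t *\<^sub>R X i | t. 0 \<le> t}" if "i \<in> I" for i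
    using is_ray_generator[OF rays[OF that]] X(1) that by blast
  ultimately have "ray_coordinates I r X f"
    using fin f(1) dual by (intro ray_coordinates.intro)
  then show ?thesis by blast
qed

section \<open>Positive roots along paths\<close>

lemma flip_flip [simp]: "flip (flip a) = a"
  by (simp add: flip_def)

lemma fst_flip [simp]: "fst (flip a) = fst a"
  by (simp add: flip_def)

lemma osrc_flip [simp]: "osrc G (flip a) = otgt G a"
  by (simp add: flip_def osrc_def otgt_def)

lemma otgt_flip [simp]: "otgt G (flip a) = osrc G a"
  by (simp add: flip_def osrc_def otgt_def)

lemma fst_eq_cases: "fst a = fst b \<Longrightarrow> a = b \<or> a = flip b"
  by (auto simp: flip_def prod_eq_iff)

lemma opposite_opposite [simp]: "opposite_ray (opposite_ray s) = s"
  by (simp add: image_image)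

lemma opposite_eq_iff [simp]: "opposite_ray s = opposite_ray t \<longleftrightarrow> s = t"
  by (simp add: inj_image_eq_iff)

lemma opposite_subset_subspace: "subspace W \<Longrightarrow> opposite_ray s \<subseteq> W \<longleftrightarrow> s \<subseteq> W"
  using subspace_neg[of W] by (auto simp: image_subset_iff) (metis minus_minus)

lemma span_opposite_ray: "span (opposite_ray s) = span s"
  using opposite_subset_subspace[of "span s" s] opposite_subset_subspace[of "span (opposite_ray s)" s]
  by (intro antisym span_minimal) (simp_all add: span_superset)

lemma flip_compact [simp]: "flip a \<in> compact_oedges G \<longleftrightarrow> a \<in> compact_oedges G"
  by (auto simp: flip_def compact_oedges_def mem_Times_iff)

lemma compact_oedge: "a \<in> compact_oedges G \<Longrightarrow> a \<in> oedges G"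
  by (simp add: oedges_def)

lemma compact_ingoing: "a \<in> compact_oedges G \<Longrightarrow> otgt G a = x \<Longrightarrow> a \<in> ingoing G x"
  by (simp add: ingoing_def compact_oedge)

lemma walk_append: "walk G u (p @ q) w \<longleftrightarrow> (\<exists>x. walk G u p x \<and> walk G x q w)"
proof (induction p arbitrary: u)
  case Nil
  then show ?case by (cases q) auto
qed auto

lemma walk_path_end: "walk G u p w \<Longrightarrow> path_end G (u, p) = w"
  by (induction p arbitrary: u) (auto simp: path_end_def split: if_splits)

lemma walk_verts: "walk G u p w \<Longrightarrow> u \<in> verts G \<and> w \<in> verts G"
  by (induction p arbitrary: u) auto

lemma walk_compact: "walk G u p w \<Longrightarrow> a \<in> set p \<Longrightarrow> a \<in> compact_oedges G"
  by (induction p arbitrary: u) auto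

lemma walk_in_paths: "walk G u p w \<Longrightarrow> (u, p) \<in> paths G"
  by (simp add: paths_def walk_path_end)

context connected_graph
begin

lemma compact_ends:
  "a \<in> compact_oedges G \<Longrightarrow> osrc G a \<in> verts G"
  "a \<in> compact_oedges G \<Longrightarrow> otgt G a \<in> verts G"
  using cedge_ends by (auto simp: compact_oedges_def osrc_def otgt_def)

lemma walk_single: "a \<in> compact_oedges G \<Longrightarrow> walk G (osrc G a) [a] (otgt G a)"
  by (simp add: compact_ends)

lemma walk_reverse: "walk G u p w \<Longrightarrow> walk G w (reverse_path p) u"
proof (induction p arbitrary: u)
  case (Cons a p)
  then show ?case
    using compact_ends[of a]
    by (auto simp: reverse_path_def walk_append intro!: exI[of _ "otgt G a"])
qed (auto simp: reverse_path_def)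

end

context matsumoto_graph
begin

lemma coordinates: "v \<in> verts G \<Longrightarrow> \<exists>X f. ray_coordinates (ingoing G v) \<rho> X f"
  using finite_dim rays_basis_coordinates[OF basis_ingoing]
  by (metis (no_types, lifting) ingoing_def mem_Collect_eq root_is_ray)

lemma pos_roots_iff: "\<alpha> \<in> pos_roots G \<rho> v \<longleftrightarrow> \<alpha> \<in> roots G \<rho> \<and> \<alpha> \<subseteq> ray_cone (\<rho> ` ingoing G v)"
  by (simp add: pos_roots_def basis_at_def)

lemma ingoing_pos_root: "a \<in> ingoing G v \<Longrightarrow> \<rho> a \<in> pos_roots G \<rho> v"
  by (auto simp: pos_roots_iff roots_def ingoing_def intro!: hull_inc)

lemma root_not_zero: "\<alpha> \<in> roots G \<rho> \<Longrightarrow> \<exists>x\<in>\<alpha>. x \<noteq> 0"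
  using root_is_ray by (force simp: roots_def is_ray_def intro: exI[of _ 1])

lemma pos_root_opposite:
  assumes "v \<in> verts G" "\<alpha> \<in> pos_roots G \<rho> v"
  shows "opposite_ray \<alpha> \<notin> pos_roots G \<rho> v"
proof
  assume "opposite_ray \<alpha> \<in> pos_roots G \<rho> v"
  moreover obtain x where "x \<in> \<alpha>" "x \<noteq> 0"
    using assms root_not_zero by (auto simp: pos_roots_iff)
  moreover obtain X f where "ray_coordinates (ingoing G v) \<rho> X f"
    using coordinates assms by blast
  ultimately show False
    using assms ray_coordinates.cone_pointed[of "ingoing G v" \<rho> X f x] by (auto simp: pos_roots_iff)
qed

lemma ingoing_root_inj:
  assumes "v \<in> verts G" "a \<in> ingoing G v" "b \<in> ingoing G v" "\<rho> a = \<rho> b"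
  shows "a = b"
  using coordinates[OF assms(1)] ray_coordinates.ray_inj assms by metis

text \<open>The step axiom for \<open>a\<close> tells which root is gained, and for
  \<open>flip a\<close> which root is lost.\<close>

lemma pos_roots_edge:
  assumes "a \<in> compact_oedges G"
  shows "pos_roots G \<rho> (otgt G a) = insert (\<rho> a) (pos_roots G \<rho> (osrc G a) - {opposite_ray (\<rho> a)})"
    and "\<rho> a \<notin> pos_roots G \<rho> (osrc G a)" and "opposite_ray (\<rho> a) \<in> pos_roots G \<rho> (osrc G a)"
  using pos_roots_step[of a] pos_roots_step[of "flip a"] root_flip[of a] assms by auto

lemma pos_roots_subset: "pos_roots G \<rho> v \<subseteq> roots G \<rho>"
  by (auto simp: pos_roots_def)

lemma walk_pos_or_opposite:
  assumes "walk G u p w" "\<alpha> \<in> pos_roots G \<rho> u \<or> opposite_ray \<alpha> \<in> pos_roots G \<rho> u"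
  shows "\<alpha> \<in> pos_roots G \<rho> w \<or> opposite_ray \<alpha> \<in> pos_roots G \<rho> w"
  using assms
proof (induction p arbitrary: u)
  case (Cons a p)
  have "\<alpha> \<in> pos_roots G \<rho> (otgt G a) \<or> opposite_ray \<alpha> \<in> pos_roots G \<rho> (otgt G a)"
    using Cons.prems pos_roots_edge(1)[of a] opposite_opposite[of \<alpha>]
    by (auto simp del: opposite_opposite)
  then show ?case using Cons by auto
qed auto

text \<open>A root might a priori have coordinates of mixed sign at \<open>v\<close>. But it is
  positive at the target of an edge carrying it, and each edge of a path only exchanges a root with
  its opposite.\<close>

lemma pos_or_opposite:
  assumes "v \<in> verts G" "\<alpha> \<in> roots G \<rho>"
  shows "\<alpha> \<in> pos_roots G \<rho> v \<or> opposite_ray \<alpha> \<in> pos_roots G \<rho> v"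
proof -
  obtain a where a: "a \<in> oedges G" "\<alpha> = \<rho> a" using assms by (auto simp: roots_def)
  have "otgt G a \<in> verts G"
    using a(1) compact_ends(2)[of a] iedge_end by (auto simp: oedges_def) (simp add: otgt_def)
  then obtain p where "walk G (otgt G a) p v" using connected assms by blast
  moreover have "\<alpha> \<in> pos_roots G \<rho> (otgt G a)" using a by (simp add: ingoing_pos_root ingoing_def)
  ultimately show ?thesis using walk_pos_or_opposite by blast
qed

text \<open>The criterion for a basis root to be crossable.\<close>

lemma compact_if_opposite_root:
  assumes "a \<in> ingoing G v" "opposite_ray (\<rho> a) \<in> roots G \<rho>"
  shows "a \<in> compact_oedges G"
  using assms opposite_infinite by (auto simp: ingoing_def oedges_def)

text \<open>A root positive at \<open>w\<close> but not at \<open>v\<close> would have its opposite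
  positive at \<open>v\<close>, hence also at \<open>w\<close>.\<close>

lemma pos_roots_subset_eq:
  assumes "v \<in> verts G" "w \<in> verts G" "pos_roots G \<rho> v \<subseteq> pos_roots G \<rho> w"
  shows "v = w"
proof (rule pos_roots_inj[OF assms(1,2)])
  show "pos_roots G \<rho> v = pos_roots G \<rho> w"
    using assms pos_or_opposite[of v] pos_root_opposite[of w] pos_roots_subset by blast
qed

text \<open>Used in contraposition: if some root positive at \<open>v\<close> is not positive at
  \<open>w\<close>, then already some basis root at \<open>v\<close> is not.\<close>

lemma pos_roots_mono:
  assumes "\<And>a. a \<in> ingoing G v \<Longrightarrow> \<rho> a \<in> pos_roots G \<rho> w"
  shows "pos_roots G \<rho> v \<subseteq> pos_roots G \<rho> w"
proof -
  have "ray_cone (\<rho> ` ingoing G v) \<subseteq> ray_cone (\<rho> ` ingoing G w)"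
    using assms by (intro hull_minimal) (auto simp: pos_roots_iff convex_cone_convex_cone_hull)
  then show ?thesis unfolding pos_roots_def basis_at_def by blast
qed

section \<open>Distances\<close>

text \<open>The analogue of the set of walls between two chambers; its cardinality turns out to be
  the distance from \<open>u\<close> to \<open>w\<close>.\<close>

definition separating :: "'v \<Rightarrow> 'v \<Rightarrow> 'a set set" where
  "separating u w = pos_roots G \<rho> u - pos_roots G \<rho> w"

text \<open>An edge removes at most one separating root. Connectedness thus makes separating sets
  finite even when there are infinitely many roots.\<close>

lemma separating_walk:
  "walk G u p w \<Longrightarrow> finite (separating u w) \<and> card (separating u w) \<le> length p"
proof (induction p arbitrary: u)
  case (Cons a p)
  then have IH: "finite (separating (otgt G a) w)" "card (separating (otgt G a) w) \<le> length p" by auto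
  have "separating u w \<subseteq> insert (opposite_ray (\<rho> a)) (separating (otgt G a) w)"
    using Cons.prems pos_roots_edge(1)[of a] by (auto simp: separating_def)
  moreover have "card (insert (opposite_ray (\<rho> a)) (separating (otgt G a) w)) \<le> Suc (length p)"
    using IH card_insert_if[OF IH(1)] by auto
  ultimately show ?case
    using IH(1) card_mono[of "insert (opposite_ray (\<rho> a)) (separating (otgt G a) w)" "separating u w"]
      finite_subset[of "separating u w"] by fastforce
qed (auto simp: separating_def)

lemma finite_separating:
  "u \<in> verts G \<Longrightarrow> w \<in> verts G \<Longrightarrow> finite (separating u w)"
  using connected separating_walk by blast

lemma separating_edge:
  assumes "a \<in> compact_oedges G" "w \<in> verts G" "\<rho> (flip a) \<notin> pos_roots G \<rho> w"
  shows "separating (osrc G a) w = insert (\<rho> (flip a)) (separating (otgt G a) w)"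
    and "\<rho> (flip a) \<notin> separating (otgt G a) w"
proof -
  have "\<rho> a \<in> pos_roots G \<rho> w"
    using pos_or_opposite[OF assms(2), of "\<rho> a"] assms root_flip[of a]
    by (auto simp: roots_def compact_oedge)
  then show "separating (osrc G a) w = insert (\<rho> (flip a)) (separating (otgt G a) w)"
    using assms pos_roots_edge[OF assms(1)] root_flip[of a] by (auto simp: separating_def)
  show "\<rho> (flip a) \<notin> separating (otgt G a) w"
    using pos_roots_step[of "flip a"] assms by (auto simp: separating_def)
qed

text \<open>Greedy descent: while separating roots exist, some basis root at \<open>u\<close> is not
  positive at \<open>w\<close>. Its opposite is then a root, so its edge is compact, and crossing it
  lowers the count by one.\<close>

lemma ex_walk_separating:
  assumes "u \<in> verts G" "w \<in> verts G"
  shows "\<exists>p. walk G u p w \<and> length p = card (separating u w)"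
  using assms
proof (induction "card (separating u w)" arbitrary: u)
  case 0
  then have "pos_roots G \<rho> u \<subseteq> pos_roots G \<rho> w"
    using finite_separating by (auto simp: separating_def)
  then have "u = w" using pos_roots_subset_eq 0 by blast
  then show ?case using 0 by (intro exI[of _ "[]"]) auto
next
  case (Suc n)
  then have "\<not> pos_roots G \<rho> u \<subseteq> pos_roots G \<rho> w"
    by (metis Diff_eq_empty_iff Zero_not_Suc card.empty separating_def)
  then obtain a where a: "a \<in> ingoing G u" "\<rho> a \<notin> pos_roots G \<rho> w"
    using pos_roots_mono by blast
  have "opposite_ray (\<rho> a) \<in> roots G \<rho>"
    using pos_or_opposite[OF Suc.prems(2), of "\<rho> a"] a pos_roots_subset
    by (auto simp: roots_def ingoing_def)
  then have c: "flip a \<in> compact_oedges G" using compact_if_opposite_root a by simp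
  have tgt: "otgt G a = u" using a by (simp add: ingoing_def)
  note sep = separating_edge[OF c Suc.prems(2)]
  have "card (separating (osrc G a) w) = n"
    using Suc.hyps(2) sep a tgt finite_separating compact_ends c Suc.prems by auto
  then obtain p where "walk G (osrc G a) p w" "length p = n"
    using Suc.hyps(1)[of "osrc G a"] compact_ends c Suc.prems by auto
  then show ?case
    using Suc c tgt by (intro exI[of _ "flip a # p"]) auto
qed

lemma shortest_path_iff:
  "shortest_path G u p w \<longleftrightarrow> walk G u p w \<and> length p = card (separating u w)"
proof
  assume *: "shortest_path G u p w"
  then obtain q where "walk G u q w" "length q = card (separating u w)"
    using ex_walk_separating walk_verts by (metis shortest_path_def)
  then show "walk G u p w \<and> length p = card (separating u w)"
    using * separating_walk[of u p w] by (force simp: shortest_path_def)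
qed (use separating_walk in \<open>auto simp: shortest_path_def\<close>)

text \<open>A first edge crossing a root positive at \<open>w\<close> would leave all separating
  roots in place, too many for the rest of the path.\<close>

lemma shortest_path_Cons:
  assumes "shortest_path G u (a # p) w"
  shows "\<rho> (flip a) \<notin> pos_roots G \<rho> w" and "shortest_path G (otgt G a) p w"
proof -
  have w: "walk G (otgt G a) p w" "a \<in> compact_oedges G" "osrc G a = u" "w \<in> verts G"
    and len: "card (separating u w) = Suc (length p)"
    using assms walk_verts[of G u "a # p" w] by (auto simp: shortest_path_iff)
  have fin: "finite (separating (otgt G a) w)" and le: "card (separating (otgt G a) w) \<le> length p"
    using separating_walk[OF w(1)] by auto
  show *: "\<rho> (flip a) \<notin> pos_roots G \<rho> w"
  proof
    assume "\<rho> (flip a) \<in> pos_roots G \<rho> w"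
    then have "separating u w \<subseteq> separating (otgt G a) w"
      using pos_roots_edge(1)[OF w(2)] w root_flip[OF w(2)] by (auto simp: separating_def)
    then have "card (separating u w) \<le> card (separating (otgt G a) w)" using fin by (rule card_mono[rotated])
    then show False using le len by linarith
  qed
  show "shortest_path G (otgt G a) p w"
    using w(1,3) separating_edge[OF w(2,4) *] len fin by (simp add: shortest_path_iff)
qed

section \<open>Rank two subgraphs\<close>

text \<open>Stated with an unnamed pair of edges so that \<open>W\<close> stays fixed while the
  vertex moves and the pair changes.\<close>

definition planar :: "'a set \<Rightarrow> 'v \<Rightarrow> bool" where
  "planar W x \<longleftrightarrow> x \<in> verts G \<and>
     (\<exists>a\<in>ingoing G x. \<exists>b\<in>ingoing G x. a \<noteq> b \<and> W = span (\<rho> a \<union> \<rho> b))"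

lemma planar_verts: "planar W x \<Longrightarrow> x \<in> verts G"
  by (simp add: planar_def)

lemma planar_subspace: "planar W x \<Longrightarrow> subspace W"
  by (auto simp: planar_def)

lemma planar_ingoing:
  assumes "x \<in> verts G" "a \<in> ingoing G x" "b \<in> ingoing G x" "c \<in> ingoing G x"
    and "\<rho> c \<subseteq> span (\<rho> a \<union> \<rho> b)"
  shows "c = a \<or> c = b"
proof -
  obtain X f where "ray_coordinates (ingoing G x) \<rho> X f"
    using coordinates assms(1) by blast
  then interpret ray_coordinates "ingoing G x" \<rho> X f .
  have "X c \<in> span (\<Union>(\<rho> ` {a, b}))"
    using assms basis_in_ray[of c] by auto
  then show ?thesis
    using assms coord_basis[of c c] by (subst (asm) span_rays) (auto dest: bspec[of _ _ c])
qed

lemma planar_span: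
  assumes "planar W x" "a \<in> ingoing G x" "b \<in> ingoing G x" "a \<noteq> b" "\<rho> a \<subseteq> W" "\<rho> b \<subseteq> W"
  shows "W = span (\<rho> a \<union> \<rho> b)"
proof -
  obtain a' b' where ab: "a' \<in> ingoing G x" "b' \<in> ingoing G x" "W = span (\<rho> a' \<union> \<rho> b')" "x \<in> verts G"
    using assms(1) by (auto simp: planar_def)
  have "a = a' \<or> a = b'" "b = a' \<or> b = b'"
    using planar_ingoing ab assms by blast+
  then show ?thesis using ab assms(4) by (auto simp: Un_commute)
qed

lemma planar_other:
  assumes "planar W x" "a \<in> ingoing G x" "\<rho> a \<subseteq> W"
  obtains b where "b \<in> ingoing G x" "b \<noteq> a" "\<rho> b \<subseteq> W"
proof -
  obtain a' b' where ab: "a' \<in> ingoing G x" "b' \<in> ingoing G x" "a' \<noteq> b'" "W = span (\<rho> a' \<union> \<rho> b')"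
    using assms(1) by (auto simp: planar_def)
  then have "\<rho> a' \<subseteq> W" "\<rho> b' \<subseteq> W" by (auto intro: span_base)
  then show ?thesis using that ab by metis
qed

lemma pos_root_planar_cone:
  assumes "planar W x" "a \<in> ingoing G x" "b \<in> ingoing G x" "a \<noteq> b" "\<rho> a \<subseteq> W" "\<rho> b \<subseteq> W"
    and "\<gamma> \<in> pos_roots G \<rho> x" "\<gamma> \<subseteq> W"
  shows "\<gamma> \<subseteq> convex_cone hull (\<rho> a \<union> \<rho> b)"
proof -
  obtain X f where "ray_coordinates (ingoing G x) \<rho> X f"
    using coordinates[OF planar_verts[OF assms(1)]] by blast
  then interpret ray_coordinates "ingoing G x" \<rho> X f .
  have "\<gamma> \<subseteq> ray_cone (\<rho> ` ingoing G x) \<inter> span (\<Union>(\<rho> ` {a, b}))"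
    using assms planar_span[OF assms(1-6)] by (auto simp: pos_roots_iff)
  then show ?thesis using cone_face[of "{a, b}"] assms(2,3) by auto
qed

text \<open>The opposite of the cone at \<open>w\<close> contains both basis roots in
  \<open>W\<close>, hence the planar cone they generate, hence \<gamma>; pointedness then forbids
  \<gamma> to be positive at \<open>w\<close>.\<close>

lemma pos_root_planar_negative:
  assumes "planar W x" "a \<in> ingoing G x" "b \<in> ingoing G x" "a \<noteq> b" "\<rho> a \<subseteq> W" "\<rho> b \<subseteq> W"
    and w: "w \<in> verts G" "\<rho> a \<notin> pos_roots G \<rho> w" "\<rho> b \<notin> pos_roots G \<rho> w"
    and \<gamma>: "\<gamma> \<in> pos_roots G \<rho> x" "\<gamma> \<subseteq> W"
  shows "\<gamma> \<notin> pos_roots G \<rho> w"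
proof
  assume pos: "\<gamma> \<in> pos_roots G \<rho> w"
  let ?K = "ray_cone (\<rho> ` ingoing G w)"
  have "opposite_ray (\<rho> c) \<subseteq> ?K" if "c \<in> ingoing G x" "\<rho> c \<notin> pos_roots G \<rho> w" for c
    using pos_or_opposite[OF w(1), of "\<rho> c"] that by (auto simp: roots_def ingoing_def pos_roots_iff)
  then have "\<rho> a \<union> \<rho> b \<subseteq> uminus ` ?K"
    using assms(2,3) w by (metis Un_least image_mono opposite_opposite)
  moreover have "convex_cone (uminus ` ?K)"
    using convex_cone_linear_image[of ?K uminus]
    by (simp add: convex_cone_convex_cone_hull linear_uminus)
  ultimately have "convex_cone hull (\<rho> a \<union> \<rho> b) \<subseteq> uminus ` ?K"
    by (rule hull_minimal)
  then have "\<gamma> \<subseteq> uminus ` ?K" using pos_root_planar_cone[OF assms(1-6) \<gamma>] by blast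
  moreover obtain y where y: "y \<in> \<gamma>" "y \<noteq> 0"
    using root_not_zero pos by (auto simp: pos_roots_iff)
  ultimately have "- y \<in> ?K" "y \<in> ?K" using pos by (force simp: pos_roots_iff)+
  moreover obtain X f where "ray_coordinates (ingoing G w) \<rho> X f"
    using coordinates w(1) by blast
  ultimately show False using ray_coordinates.cone_pointed y by blast
qed

text \<open>
  Modulo the crossed root, the second root \<open>\<rho> b\<close> of the plane is a nonnegative combination
  of the new basis, all of whose members but one are positive at the old vertex. Members
  with nonzero coefficient therefore have no component outside the plane.
\<close>

lemma planar_step:
  assumes "planar W x" "a \<in> compact_oedges G" "osrc G a = x" "\<rho> a \<subseteq> W"
  shows "planar W (otgt G a)"
proof -
  define x' where "x' = otgt G a"
  have x: "x \<in> verts G" "x' \<in> verts G"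
    using assms(1) compact_ends(2)[OF assms(2)] by (simp_all add: planar_verts x'_def)
  obtain X f where "ray_coordinates (ingoing G x) \<rho> X f" using coordinates x by blast
  then interpret A: ray_coordinates "ingoing G x" \<rho> X f .
  obtain Y g where "ray_coordinates (ingoing G x') \<rho> Y g" using coordinates x by blast
  then interpret B: ray_coordinates "ingoing G x'" \<rho> Y g .
  note sub = planar_subspace[OF assms(1)]
  define a' where "a' = flip a"
  have opp: "\<rho> a' = opposite_ray (\<rho> a)" using root_flip assms by (simp add: a'_def)
  have a': "a' \<in> ingoing G x" "\<rho> a' \<subseteq> W"
    using assms(2-4) opposite_subset_subspace[OF sub] opp by (simp_all add: a'_def compact_ingoing)
  have a: "a \<in> ingoing G x'" using assms by (simp add: x'_def compact_ingoing)
  obtain b where b: "b \<in> ingoing G x" "b \<noteq> a'" "\<rho> b \<subseteq> W"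
    using planar_other[OF assms(1) a'] by blast
  have W: "W = span (\<Union>(\<rho> ` {a', b}))"
    using planar_span[OF assms(1) a'(1) b(1)] a' b by auto
  \<comment> \<open>Only \<open>\<rho> a'\<close> ceases to be positive on the way to
    \<open>x'\<close>, and \<open>b\<close> differs from \<open>a'\<close>.\<close>
  have "\<rho> b \<in> pos_roots G \<rho> x'"
    using pos_roots_edge(1)[OF assms(2)] assms b ingoing_pos_root[OF b(1)] opp
      ingoing_root_inj[OF x(1) b(1) a'(1)] by (auto simp: x'_def)
  then have nonneg: "\<forall>d\<in>ingoing G x'. 0 \<le> g d (X b)"
    using A.basis_in_ray[OF b(1)] B.cone_all by (auto simp: pos_roots_iff)
  have spana: "span (\<rho> a) = span (\<rho> a')"
    by (simp add: opp span_opposite_ray)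
  \<comment> \<open>Otherwise \<open>X b\<close> would lie on the line of the crossed root, against
    independence of the basis at \<open>x\<close>.\<close>
  have "\<exists>c\<in>ingoing G x'. c \<noteq> a \<and> g c (X b) \<noteq> 0"
  proof (rule ccontr)
    assume "\<not> ?thesis"
    then have "X b \<in> span (\<Union>(\<rho> ` {a}))" using a by (subst B.span_rays) auto
    then have "X b \<in> span (\<Union>(\<rho> ` {a'}))" using spana by simp
    then have "f b (X b) = 0" using a' b by (subst (asm) A.span_rays) auto
    then show False using A.coord_basis b by simp
  qed
  then obtain c where c: "c \<in> ingoing G x'" "c \<noteq> a" "g c (X b) > 0" using nonneg by force
  have "f e (Y c) = 0" if e: "e \<in> ingoing G x - {a', b}" for e
  proof -
    \<comment> \<open>The exceptional member \<open>\<rho> a\<close> of the new basis lies on the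
      line of \<open>\<rho> a'\<close>, where the coordinate \<open>f e\<close> vanishes.\<close>
    have pos: "0 \<le> f e (Y d)" if d: "d \<in> ingoing G x'" for d
    proof (cases "d = a")
      case True
      have "- Y a \<in> \<rho> a'" using B.basis_in_ray[OF a] opp by auto
      then have "f e (- Y a) = 0" using A.coord_ray[of e a'] e a' by auto
      then show ?thesis using True e A.linear_coord[of e] by (simp add: linear_neg)
    next
      case False
      then have "\<rho> d \<noteq> \<rho> a" using ingoing_root_inj[OF x(2) d a] by blast
      then have "\<rho> d \<in> pos_roots G \<rho> x"
        using ingoing_pos_root[OF d] pos_roots_edge(1)[OF assms(2)] assms by (auto simp: x'_def)
      then show ?thesis using B.basis_in_ray[OF d] e A.cone_all by (auto simp: pos_roots_iff)
    qed
    have le: "linear (f e)" using A.linear_coord e by simp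
    have "0 = f e (X b)" using A.coord_basis[of e b] e b by auto
    also have "\<dots> = (\<Sum>d\<in>ingoing G x'. g d (X b) * f e (Y d))"
      by (subst B.expansion[of "X b"]) (simp add: linear_sum[OF le] linear_scale[OF le])
    finally have "\<forall>d\<in>ingoing G x'. g d (X b) * f e (Y d) = 0"
      using nonneg pos B.finite_index by (subst (asm) eq_commute, subst (asm) sum_nonneg_eq_0_iff) auto
    then show ?thesis using c by force
  qed
  then have Yc: "Y c \<in> W" unfolding W using a' b by (subst A.span_rays) auto
  then have cW: "\<rho> c \<subseteq> W" using B.ray_eq[OF c(1)] sub by (auto simp: subspace_scale)
  \<comment> \<open>\<open>Y c\<close> is off the line of the crossed root, so its expansion in
    \<open>X a'\<close> and \<open>X b\<close> can be solved for \<open>X b\<close>. This gives the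
    inclusion of \<open>W\<close> in the span of the new pair.\<close>
  have "f b (Y c) \<noteq> 0"
  proof
    assume "f b (Y c) = 0"
    then have "Y c \<in> span (\<Union>(\<rho> ` {a'}))"
      using Yc a' b unfolding W by (subst (asm) A.span_rays, simp, subst A.span_rays) auto
    then have "Y c \<in> span (\<Union>(\<rho> ` {a}))" using spana by simp
    then have "g c (Y c) = 0" using a c by (subst (asm) B.span_rays) auto
    then show False using B.coord_basis c by simp
  qed
  moreover have "Y c = f a' (Y c) *\<^sub>R X a' + f b (Y c) *\<^sub>R X b"
    using A.expansion_on[of "{a', b}" "Y c"] a' b Yc unfolding W by (subst (asm) A.span_rays) auto
  ultimately have "X b = (1 / f b (Y c)) *\<^sub>R (Y c - f a' (Y c) *\<^sub>R X a')"
    by (metis add_diff_cancel_left' divide_self_if scaleR_one scaleR_scaleR times_divide_eq_left mult_1)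
  moreover have "Y c \<in> span (\<rho> a \<union> \<rho> c)" using B.basis_in_ray[OF c(1)] by (auto intro: span_base)
  moreover have aa: "\<rho> a' \<subseteq> span (\<rho> a \<union> \<rho> c)"
    using spana span_superset[of "\<rho> a'"] span_mono[of "\<rho> a" "\<rho> a \<union> \<rho> c"] by auto
  ultimately have Xb: "X b \<in> span (\<rho> a \<union> \<rho> c)"
    using A.basis_in_ray[OF a'(1)] by (metis span_diff span_scale subsetD)
  then have "\<rho> b \<subseteq> span (\<rho> a \<union> \<rho> c)" using A.ray_eq[OF b(1)] by (auto intro: span_scale)
  then have "W \<subseteq> span (\<rho> a \<union> \<rho> c)" unfolding W using aa by (intro span_minimal) auto
  moreover have "span (\<rho> a \<union> \<rho> c) \<subseteq> W" using cW assms(4) sub by (intro span_minimal) auto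
  ultimately have "W = span (\<rho> a \<union> \<rho> c)" by (rule subset_antisym)
  then show ?thesis using x(2) a c(1,2) unfolding planar_def x'_def by metis
qed

lemma no_loop: "a \<in> compact_oedges G \<Longrightarrow> osrc G a \<noteq> otgt G a"
  using pos_roots_step by fastforce

lemma planar_walk:
  "walk G x p y \<Longrightarrow> planar W x \<Longrightarrow> \<forall>a\<in>set p. \<rho> a \<subseteq> W \<Longrightarrow> planar W y"
  by (induction p arbitrary: x) (auto intro: planar_step)

section \<open>Circuits inside a plane\<close>

lemma walk_ends:
  "walk G u p w \<Longrightarrow> insert w (osrc G ` set p) = insert u (otgt G ` set p)"
  by (induction p arbitrary: u) auto

text \<open>A closed walk enters every vertex that it leaves, which supplies two of its oriented
  edges at each vertex.\<close>

lemma circuit_ends: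
  assumes "walk G u c u" "c \<noteq> []"
  shows "osrc G ` set c = otgt G ` set c"
proof -
  have "u = otgt G (last c)" using walk_path_end[OF assms(1)] assms(2) by (simp add: path_end_def)
  then have "u \<in> otgt G ` set c" using assms(2) by simp
  moreover have "u \<in> osrc G ` set c" using assms by (cases c) auto
  ultimately show ?thesis using walk_ends[OF assms(1)] by (simp add: insert_absorb)
qed

text \<open>
  A simple circuit uses two different edges at each of its vertices, and there are
  only two edges of the plane at a vertex.
\<close>

lemma circuit_contains_ingoing:
  assumes c: "walk G u c u" "\<forall>a\<in>set c. \<rho> a \<subseteq> W" "distinct (map fst c)"
    and x: "x \<in> osrc G ` set c" "planar W x"
    and e: "e \<in> ingoing G x" "\<rho> e \<subseteq> W"
  shows "\<exists>d\<in>set c. e = d \<or> e = flip d"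
proof -
  obtain d where d: "d \<in> set c" "osrc G d = x" using x by auto
  then have "osrc G ` set c = otgt G ` set c"
    using circuit_ends[OF c(1)] by (metis empty_iff list.set(1))
  then obtain d' where d': "d' \<in> set c" "otgt G d' = x" using x by auto
  have comp: "d \<in> compact_oedges G" "d' \<in> compact_oedges G"
    using walk_compact[OF c(1)] d d' by auto
  then have "d \<noteq> d'" using no_loop[of d] d d' by auto
  \<comment> \<open>The underlying edges must differ: if \<open>d'\<close> were
    \<open>flip d\<close>, the circuit would show only one basis root at \<open>x\<close>.\<close>
  then have "fst d \<noteq> fst d'" using c(3) d d' by (auto simp: distinct_map inj_on_def)
  then have ne: "flip d \<noteq> d'" by (metis fst_flip)
  have in1: "flip d \<in> ingoing G x" and in2: "d' \<in> ingoing G x"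
    using comp d d' by (simp_all add: compact_ingoing)
  have "\<rho> (flip d) \<subseteq> W"
    using root_flip[OF comp(1)] opposite_subset_subspace[OF planar_subspace[OF x(2)]] c(2) d by simp
  then have "W = span (\<rho> (flip d) \<union> \<rho> d')"
    using planar_span[OF x(2) in1 in2 ne] c(2) d' by simp
  then have "e = flip d \<or> e = d'"
    using planar_ingoing[OF planar_verts[OF x(2)] in1 in2 e(1)] e(2) by simp
  then show ?thesis using d d' by blast
qed

text \<open>The circuit contains all edges of the plane at each of its vertices, so a walk in the
  plane cannot leave it.\<close>

lemma circuit_absorbs_walk:
  assumes c: "walk G u c u" "\<forall>a\<in>set c. \<rho> a \<subseteq> W" "distinct (map fst c)"
  shows "walk G x p y \<Longrightarrow> \<forall>a\<in>set p. \<rho> a \<subseteq> W \<Longrightarrow> planar W x \<Longrightarrow> x \<in> osrc G ` set c \<Longrightarrow>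
    y \<in> osrc G ` set c"
proof (induction p arbitrary: x)
  case (Cons a p)
  have a: "a \<in> compact_oedges G" "osrc G a = x" "\<rho> a \<subseteq> W" using Cons.prems by auto
  have "flip a \<in> ingoing G x" "\<rho> (flip a) \<subseteq> W"
    using a root_flip[OF a(1)] opposite_subset_subspace[OF planar_subspace[OF Cons.prems(3)]]
    by (simp_all add: compact_ingoing)
  then obtain d where d: "d \<in> set c" "flip a = d \<or> flip a = flip d"
    using circuit_contains_ingoing[OF c] Cons.prems by blast
  then have "otgt G a \<in> osrc G ` set c \<union> otgt G ` set c"
    by (metis UnCI flip_flip image_eqI osrc_flip)
  moreover have "otgt G ` set c \<subseteq> osrc G ` set c"
    using circuit_ends[OF c(1)] d(1) by force
  ultimately show ?case
    using Cons.IH[of "otgt G a"] Cons.prems planar_step[OF Cons.prems(3) a] by auto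
qed auto

section \<open>The rank two subgraph described by walks in the plane\<close>

text \<open>The subgraph tests only the orientation with sign \<open>True\<close>, but a subspace
  contains a ray exactly when it contains the opposite ray.\<close>

lemma root_subset_subspace:
  assumes "a \<in> compact_oedges G" "subspace W"
  shows "\<rho> a \<subseteq> W \<longleftrightarrow> \<rho> (fst a, True) \<subseteq> W"
proof (cases "snd a")
  case True
  then have "a = (fst a, True)" by (simp add: prod_eq_iff)
  then show ?thesis by simp
next
  case False
  then have "flip a = (fst a, True)" by (simp add: flip_def)
  then show ?thesis
    using root_flip[OF assms(1)] opposite_subset_subspace[OF assms(2)] by simp
qed

lemma rank_two_subgraph_simps:
  fixes v \<alpha> \<beta>
  defines "H \<equiv> rank_two_subgraph G \<rho> v \<alpha> \<beta>" and "W \<equiv> span (\<alpha> \<union> \<beta>)"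
  shows "osrc H = osrc G" and "otgt H = otgt G"
    and "verts H = {y. \<exists>p. walk G v p y \<and> (\<forall>a\<in>set p. \<rho> a \<subseteq> W)}"
    and "cedges H = {e \<in> cedges G. \<rho> (e, True) \<subseteq> W \<and> head G e \<in> verts H}"
    and "iedges H = {e \<in> iedges G. \<rho> (e, True) \<subseteq> W \<and> head G e \<in> verts H}"
proof -
  let ?H0 = "G\<lparr>cedges := {e \<in> cedges G. \<rho> (e, True) \<subseteq> W}, iedges := {e \<in> iedges G. \<rho> (e, True) \<subseteq> W}\<rparr>"
  have H: "H = component ?H0 v" by (simp add: H_def W_def rank_two_subgraph_def Let_def)
  show "osrc H = osrc G" "otgt H = otgt G"
    by (auto simp: H component_def osrc_def otgt_def Let_def)
  have ends: "osrc ?H0 = osrc G" "otgt ?H0 = otgt G" by (auto simp: osrc_def otgt_def)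
  have "a \<in> compact_oedges ?H0 \<longleftrightarrow> a \<in> compact_oedges G \<and> \<rho> a \<subseteq> W" for a
    using root_subset_subspace[of a W] by (auto simp: compact_oedges_def mem_Times_iff W_def)
  then have "walk ?H0 x p y \<longleftrightarrow> walk G x p y \<and> (\<forall>a\<in>set p. \<rho> a \<subseteq> W)" for x p y
    by (induction p arbitrary: x) (auto simp: ends)
  then show "verts H = {y. \<exists>p. walk G v p y \<and> (\<forall>a\<in>set p. \<rho> a \<subseteq> W)}"
    by (simp add: H component_def Let_def)
  show "cedges H = {e \<in> cedges G. \<rho> (e, True) \<subseteq> W \<and> head G e \<in> verts H}"
    "iedges H = {e \<in> iedges G. \<rho> (e, True) \<subseteq> W \<and> head G e \<in> verts H}"
    by (auto simp: H component_def Let_def)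
qed

lemma rank_two_subgraph_walk:
  fixes v \<alpha> \<beta>
  defines "H \<equiv> rank_two_subgraph G \<rho> v \<alpha> \<beta>" and "W \<equiv> span (\<alpha> \<union> \<beta>)"
  shows "x \<in> verts H \<Longrightarrow> walk G x p y \<Longrightarrow> \<forall>a\<in>set p. \<rho> a \<subseteq> W \<Longrightarrow> walk H x p y"
proof (induction p arbitrary: x)
  case (Cons a p)
  note simps = rank_two_subgraph_simps[of v \<alpha> \<beta>, folded H_def W_def]
  have a: "a \<in> compact_oedges G" "osrc G a = x" "\<rho> a \<subseteq> W" using Cons.prems by auto
  obtain q where q: "walk G v q x" "\<forall>a\<in>set q. \<rho> a \<subseteq> W" using Cons.prems simps(3) by auto
  have "walk G v (q @ [a]) (otgt G a)"
    using a q walk_single[OF a(1)] by (auto simp: walk_append)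
  moreover have "\<forall>b\<in>set (q @ [a]). \<rho> b \<subseteq> W" using q a by simp
  ultimately have t: "otgt G a \<in> verts H" unfolding simps(3) by blast
  \<comment> \<open>The component selects edges by their head, which is the source or the target of
    \<open>a\<close> according to its sign.\<close>
  have "head G (fst a) \<in> verts H"
    using t a Cons.prems(1) by (auto simp: osrc_def otgt_def split: if_splits)
  moreover have "\<rho> (fst a, True) \<subseteq> W"
    using root_subset_subspace[OF a(1), of W] a(3) by (simp add: W_def)
  ultimately have "a \<in> compact_oedges H"
    using a(1) by (auto simp: compact_oedges_def mem_Times_iff simps(4))
  then show ?case using Cons t a by (simp add: simps(1,2))
qed (auto simp: H_def)

end

section \<open>Descents to the opposite vertex of a finite rank two subgraph\<close>

locale finite_rank_two = matsumoto_graph G \<rho>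
  for G :: "('v, 'e) graph" and \<rho> :: "'e oedge \<Rightarrow> 'a::real_vector set" +
  fixes v :: 'v and W :: "'a set"
  assumes planar_base: "planar W v"
    and finite_plane: "finite {\<gamma> \<in> pos_roots G \<rho> v. \<gamma> \<subseteq> W}"
    and plane_opposite: "\<gamma> \<in> pos_roots G \<rho> v \<Longrightarrow> \<gamma> \<subseteq> W \<Longrightarrow> opposite_ray \<gamma> \<in> roots G \<rho>"
begin

definition plane_roots :: "'a set set" where
  "plane_roots = {\<gamma> \<in> pos_roots G \<rho> v. \<gamma> \<subseteq> W}"

text \<open>The plane roots at \<open>v\<close> that a walk from \<open>v\<close> to \<open>x\<close> still has to cross on the way around.\<close>

definition remaining :: "'v \<Rightarrow> 'a set set" where
  "remaining x = plane_roots \<inter> pos_roots G \<rho> x"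

text \<open>The root lost along \<open>a\<close> is \<open>\<rho> (flip a)\<close>. Requiring it to
  be positive at \<open>v\<close> makes every edge move away from \<open>v\<close> inside the
  plane.\<close>

definition descending :: "'e oedge list \<Rightarrow> bool" where
  "descending p \<longleftrightarrow> (\<forall>a\<in>set p. \<rho> (flip a) \<in> plane_roots)"

lemma base_vertex: "v \<in> verts G"
  using planar_base by (rule planar_verts)

lemma finite_remaining: "finite (remaining x)"
  using finite_plane by (simp add: remaining_def plane_roots_def)

lemma remaining_base: "remaining v = plane_roots"
  by (auto simp: remaining_def plane_roots_def)

lemma descending_root:
  assumes "a \<in> compact_oedges G" "\<rho> (flip a) \<in> plane_roots"
  shows "\<rho> a \<subseteq> W" and "\<rho> a \<notin> pos_roots G \<rho> v"
  using assms root_flip[OF assms(1)] opposite_subset_subspace[OF planar_subspace[OF planar_base]]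
    pos_root_opposite[OF base_vertex] by (auto simp: plane_roots_def)

lemma descending_edge:
  assumes "a \<in> compact_oedges G" "\<rho> (flip a) \<in> plane_roots"
  shows "remaining (osrc G a) = insert (\<rho> (flip a)) (remaining (otgt G a))"
    and "\<rho> (flip a) \<notin> remaining (otgt G a)"
    and "{\<gamma> \<in> pos_roots G \<rho> (otgt G a). \<not> \<gamma> \<subseteq> W} = {\<gamma> \<in> pos_roots G \<rho> (osrc G a). \<not> \<gamma> \<subseteq> W}"
proof -
  note pos = pos_roots_edge[OF assms(1), folded root_flip[OF assms(1)]]
  have "\<rho> (flip a) \<noteq> \<rho> a" using pos(2,3) by auto
  then show "remaining (osrc G a) = insert (\<rho> (flip a)) (remaining (otgt G a))"
    "\<rho> (flip a) \<notin> remaining (otgt G a)"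
    using pos assms(2) descending_root[OF assms] by (auto simp: remaining_def plane_roots_def)
  have "\<rho> (flip a) \<subseteq> W" using assms(2) by (simp add: plane_roots_def)
  then show "{\<gamma> \<in> pos_roots G \<rho> (otgt G a). \<not> \<gamma> \<subseteq> W} = {\<gamma> \<in> pos_roots G \<rho> (osrc G a). \<not> \<gamma> \<subseteq> W}"
    using pos(1) descending_root(1)[OF assms] by auto
qed

lemma card_descending_edge:
  assumes "a \<in> compact_oedges G" "\<rho> (flip a) \<in> plane_roots"
  shows "card (remaining (osrc G a)) = Suc (card (remaining (otgt G a)))"
  using descending_edge[OF assms] finite_remaining by simp

text \<open>Each edge uses up exactly one remaining root, which later gives the two sides of the
  polygon equal length.\<close>

lemma descending_walk:
  assumes "walk G x p y" "descending p"
  shows "card (remaining x) = length p + card (remaining y)"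
    and "{\<gamma> \<in> pos_roots G \<rho> y. \<not> \<gamma> \<subseteq> W} = {\<gamma> \<in> pos_roots G \<rho> x. \<not> \<gamma> \<subseteq> W}"
    and "\<forall>a\<in>set p. \<rho> a \<subseteq> W"
    and "planar W x \<Longrightarrow> planar W y"
proof -
  show "card (remaining x) = length p + card (remaining y)"
    using assms by (induction p arbitrary: x) (auto simp: descending_def card_descending_edge)
  show "{\<gamma> \<in> pos_roots G \<rho> y. \<not> \<gamma> \<subseteq> W} = {\<gamma> \<in> pos_roots G \<rho> x. \<not> \<gamma> \<subseteq> W}"
    using assms
  proof (induction p arbitrary: x)
    case (Cons a p)
    then show ?case using Cons.IH[of "otgt G a"] descending_edge(3)[of a] by (simp add: descending_def)
  qed simp
  show *: "\<forall>a\<in>set p. \<rho> a \<subseteq> W"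
    using assms walk_compact[OF assms(1)] descending_root(1) by (auto simp: descending_def)
  show "planar W x \<Longrightarrow> planar W y" using planar_walk[OF assms(1) _ *] .
qed

text \<open>The planar cone argument read backwards, from \<open>x\<close> towards \<open>v\<close>;
  such an \<open>x\<close> is the vertex opposite to \<open>v\<close>.\<close>

lemma remaining_empty:
  assumes "planar W x" "a \<in> ingoing G x" "b \<in> ingoing G x" "a \<noteq> b" "\<rho> a \<subseteq> W" "\<rho> b \<subseteq> W"
    and "\<rho> a \<notin> pos_roots G \<rho> v" "\<rho> b \<notin> pos_roots G \<rho> v"
  shows "remaining x = {}"
  using pos_root_planar_negative[OF assms(1-6) base_vertex assms(7,8)]
  by (auto simp: remaining_def plane_roots_def)

text \<open>By \<open>remaining_empty\<close>, one of the two plane roots in the basis at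
  \<open>x\<close> is positive at \<open>v\<close>; its opposite is a root, so its edge is compact
  and can be crossed.\<close>

lemma ex_descending_edge:
  assumes "planar W x" "remaining x \<noteq> {}"
  shows "\<exists>a\<in>compact_oedges G. osrc G a = x \<and> \<rho> (flip a) \<in> plane_roots"
proof -
  obtain a b where ab: "a \<in> ingoing G x" "b \<in> ingoing G x" "a \<noteq> b" "W = span (\<rho> a \<union> \<rho> b)"
    using assms(1) by (auto simp: planar_def)
  then have "\<rho> a \<subseteq> W" "\<rho> b \<subseteq> W" by (auto intro: span_base)
  then obtain c where c: "c \<in> ingoing G x" "\<rho> c \<in> plane_roots"
    using remaining_empty[OF assms(1) ab(1-3)] assms(2) ab(1,2)
    unfolding plane_roots_def by blast
  then have "c \<in> compact_oedges G"
    using compact_if_opposite_root plane_opposite by (simp add: plane_roots_def)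
  then show ?thesis using c by (intro bexI[of _ "flip c"]) (auto simp: ingoing_def)
qed

lemma ex_descending_walk:
  "planar W x \<Longrightarrow> \<exists>p u. walk G x p u \<and> descending p \<and> remaining u = {}"
proof (induction "card (remaining x)" arbitrary: x)
  case 0
  then show ?case
    using finite_remaining planar_verts by (intro exI[of _ "[]"]) (auto simp: descending_def)
next
  case (Suc n)
  then obtain a where a: "a \<in> compact_oedges G" "osrc G a = x" "\<rho> (flip a) \<in> plane_roots"
    using ex_descending_edge[OF Suc.prems] by force
  then have "card (remaining (otgt G a)) = n" "planar W (otgt G a)"
    using Suc card_descending_edge[OF a(1,3)] planar_step descending_root[OF a(1,3)] by auto
  then obtain p u where "walk G (otgt G a) p u" "descending p" "remaining u = {}"
    using Suc.hyps by blast
  then show ?case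
    using a Suc.prems planar_verts
    by (intro exI[of _ "a # p"] exI[of _ u]) (auto simp: descending_def)
qed

text \<open>The positive roots at the end are determined by \<open>v\<close> and \<open>W\<close>:
  outside \<open>W\<close> they are those at \<open>v\<close>, and inside \<open>W\<close> no root
  positive at \<open>v\<close> is left.\<close>

lemma descending_end_unique:
  assumes "walk G v p u" "descending p" "remaining u = {}"
    and "walk G v q w" "descending q" "remaining w = {}"
  shows "u = w"
proof -
  have sub: "pos_roots G \<rho> y \<subseteq> pos_roots G \<rho> z"
    if y: "walk G v r y" "descending r" "remaining y = {}"
      and z: "walk G v s z" "descending s" "remaining z = {}" for r y s z
  proof
    fix \<gamma> assume \<gamma>: "\<gamma> \<in> pos_roots G \<rho> y"
    show "\<gamma> \<in> pos_roots G \<rho> z"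
    proof (cases "\<gamma> \<subseteq> W")
      case True
      have root: "\<gamma> \<in> roots G \<rho>" using \<gamma> pos_roots_subset by blast
      have "\<gamma> \<notin> pos_roots G \<rho> v"
        using True \<gamma> y(3) by (auto simp: remaining_def plane_roots_def)
      then have "opposite_ray \<gamma> \<in> plane_roots"
        using pos_or_opposite[OF base_vertex root] True
          opposite_subset_subspace[OF planar_subspace[OF planar_base]] by (simp add: plane_roots_def)
      then have "opposite_ray \<gamma> \<notin> pos_roots G \<rho> z"
        using z(3) by (auto simp: remaining_def)
      then show ?thesis using pos_or_opposite[OF _ root] walk_verts[OF z(1)] by blast
    next
      case False
      then show ?thesis using descending_walk(2)[OF y(1,2)] descending_walk(2)[OF z(1,2)] \<gamma> by blast
    qed
  qed
  show ?thesis
    using walk_verts[OF assms(1)] walk_verts[OF assms(4)] sub[OF assms]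
    by (intro pos_roots_subset_eq) simp_all
qed

text \<open>Before the opposite vertex is reached, only one edge of the plane leads back towards \<open>v\<close>.\<close>

lemma descending_walk_unique:
  assumes "walk G v p x" "descending p" "walk G v q x" "descending q" "remaining x \<noteq> {}"
  shows "p = q"
  using assms
proof (induction p arbitrary: q x rule: rev_induct)
  case Nil
  then show ?case using descending_walk(1)[OF Nil(3,4)] by simp
next
  case (snoc a p)
  have "q \<noteq> []"
    using descending_walk(1)[OF snoc.prems(1,2)] snoc.prems(3) by auto
  then obtain q' b where q: "q = q' @ [b]" by (cases q rule: rev_cases) auto
  have a: "walk G v p (osrc G a)" "a \<in> compact_oedges G" "otgt G a = x" "\<rho> (flip a) \<in> plane_roots"
    "descending p"
    using snoc.prems by (auto simp: walk_append descending_def)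
  have b: "walk G v q' (osrc G b)" "b \<in> compact_oedges G" "otgt G b = x" "\<rho> (flip b) \<in> plane_roots"
    "descending q'"
    using snoc.prems q by (auto simp: walk_append descending_def)
  have "a = b"
  proof (rule ccontr)
    assume "a \<noteq> b"
    then have "remaining x = {}"
      using remaining_empty[of x a b] descending_root[OF a(2,4)] descending_root[OF b(2,4)] a b
        descending_walk(4)[OF snoc.prems(1,2) planar_base] by (simp add: compact_ingoing)
    then show False using snoc.prems by simp
  qed
  moreover have "remaining (osrc G a) \<noteq> {}" using descending_edge(1)[OF a(2,4)] by simp
  ultimately show ?case using snoc.IH[OF a(1,5), of q'] b q by auto
qed

text \<open>The number of remaining roots drops along every edge. The bound is weak for sources
  because the first source is \<open>x\<close> itself.\<close>

lemma descending_walk_distinct: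
  "walk G x p y \<Longrightarrow> descending p \<Longrightarrow> distinct (map (osrc G) p) \<and> distinct (map (otgt G) p) \<and>
    (\<forall>a\<in>set p. card (remaining (osrc G a)) \<le> card (remaining x) \<and>
      card (remaining (otgt G a)) < card (remaining x))"
proof (induction p arbitrary: x)
  case (Cons a p)
  have a: "a \<in> compact_oedges G" "\<rho> (flip a) \<in> plane_roots" "osrc G a = x"
    using Cons.prems by (auto simp: descending_def)
  have "distinct (map (osrc G) p) \<and> distinct (map (otgt G) p) \<and>
    (\<forall>b\<in>set p. card (remaining (osrc G b)) \<le> card (remaining (otgt G a)) \<and>
      card (remaining (otgt G b)) < card (remaining (otgt G a)))"
    using Cons.IH[of "otgt G a"] Cons.prems by (auto simp: descending_def)
  then show ?case using card_descending_edge[OF a(1,2)] a(3) by fastforce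
qed auto

text \<open>No edge descends in both orientations, as its two opposite roots would both be positive
  at \<open>v\<close>.\<close>

lemma descending_fst_inj:
  assumes "a \<in> compact_oedges G" "b \<in> compact_oedges G"
    and "\<rho> (flip a) \<in> plane_roots" "\<rho> (flip b) \<in> plane_roots" "fst a = fst b"
  shows "a = b"
  using fst_eq_cases[OF assms(5)] descending_root(2)[OF assms(1,3)] assms(4)
  by (auto simp: plane_roots_def)

lemma descending_circuit:
  assumes p: "walk G v p u" "descending p" and q: "walk G v q u" "descending q"
    and ne: "hd p \<noteq> hd q"
  shows "distinct (map (osrc G) (p @ reverse_path q))" "distinct (map fst (p @ reverse_path q))"
proof -
  \<comment> \<open>Writing the first edge as \<open>hd (p1 @ [a])\<close> also covers an empty
    prefix \<open>p1\<close>.\<close>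
  have start: "\<exists>p1. walk G v p1 (osrc G a) \<and> descending p1 \<and> hd (p1 @ [a]) = hd p \<and>
      a \<in> compact_oedges G \<and> \<rho> (flip a) \<in> plane_roots"
    if p: "walk G v p u" "descending p" and a: "a \<in> set p" for p a
  proof -
    obtain p1 p2 where "p = p1 @ a # p2" using a by (auto simp: in_set_conv_decomp)
    then show ?thesis
      using p by (intro exI[of _ p1]) (auto simp: walk_append descending_def hd_append)
  qed
  \<comment> \<open>The sources of the reversed \<open>q\<close> are the targets of
    \<open>q\<close>. A coincidence would give two descending walks to a vertex with remaining
    roots, hence equal walks and equal first edges.\<close>
  have *: "osrc G a \<noteq> otgt G b \<and> a \<noteq> b" if a: "a \<in> set p" and b: "b \<in> set q" for a b
  proof -
    obtain p1 where p1: "walk G v p1 (osrc G a)" "descending p1" "hd (p1 @ [a]) = hd p"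
      "a \<in> compact_oedges G" "\<rho> (flip a) \<in> plane_roots"
      using start[OF p a] by blast
    obtain q1 where q1: "walk G v q1 (osrc G b)" "descending q1" "hd (q1 @ [b]) = hd q"
      "b \<in> compact_oedges G" "\<rho> (flip b) \<in> plane_roots"
      using start[OF q b] by blast
    have rem: "remaining (osrc G a) \<noteq> {}" using descending_edge(1)[OF p1(4,5)] by simp
    have "osrc G a \<noteq> otgt G b"
    proof
      assume eq: "osrc G a = otgt G b"
      have "walk G v (q1 @ [b]) (osrc G a)"
        using q1 eq walk_single[OF q1(4)] by (auto simp: walk_append)
      then have "p1 = q1 @ [b]"
        using descending_walk_unique[OF p1(1,2)] q1(2,5) rem by (auto simp: descending_def)
      then show False using p1(3) q1(3) ne by (simp add: hd_append split: if_splits)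
    qed
    moreover have "a \<noteq> b"
      using descending_walk_unique[OF p1(1,2) _ q1(2) rem] q1(1,3) p1(3) ne by auto
    ultimately show ?thesis by simp
  qed
  have dp: "distinct (map (osrc G) p)" "distinct (map (otgt G) q)" "distinct (map (osrc G) q)"
    using descending_walk_distinct p q by blast+
  have "map (osrc G) (reverse_path q) = rev (map (otgt G) q)"
    by (simp add: reverse_path_def rev_map)
  then show "distinct (map (osrc G) (p @ reverse_path q))" using dp * by fastforce
  have inj: "inj_on fst (set p \<union> set q)"
    using p q walk_compact descending_fst_inj unfolding inj_on_def descending_def by (metis Un_iff)
  have "distinct p" "distinct q" using dp by (auto simp: distinct_map)
  then have "distinct (map fst (p @ q))"
    using inj * by (subst distinct_map) auto
  moreover have "map fst (reverse_path q) = rev (map fst q)"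
    by (simp add: reverse_path_def rev_map)
  ultimately show "distinct (map fst (p @ reverse_path q))" by auto
qed

lemma rank_two_full_circuit:
  assumes "W = span (\<alpha> \<union> \<beta>)" and H: "H = rank_two_subgraph G \<rho> v \<alpha> \<beta>"
    and p: "walk G v p u" "descending p" "p \<noteq> []" and q: "walk G v q u" "descending q"
    and ne: "hd p \<noteq> hd q"
  shows "full_circuit H v (p @ reverse_path q)" and "iedges H = {}"
proof -
  define c where "c = p @ reverse_path q"
  note simps = rank_two_subgraph_simps[of v \<alpha> \<beta>, folded H assms(1)]
  have c: "walk G v c v" using p q walk_reverse by (auto simp: c_def walk_append)
  have cW: "\<forall>a\<in>set c. \<rho> a \<subseteq> W"
    using descending_walk(3)[OF p(1,2)] q(2)
    unfolding c_def reverse_path_def descending_def plane_roots_def by fastforce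
  have dist: "distinct (map (osrc G) c)" "distinct (map fst c)"
    using descending_circuit[OF p(1,2) q ne] by (simp_all add: c_def)
  have v: "v \<in> osrc G ` set c" using p by (cases p) (auto simp: c_def)
  have vH: "v \<in> verts H" unfolding simps(3) using base_vertex by (auto intro!: exI[of _ "[]"])
  have planarH: "planar W y" if "y \<in> verts H" for y
    using that planar_walk planar_base unfolding simps(3) by blast
  have cH: "walk H v c v"
    using rank_two_subgraph_walk[where v = v and \<alpha> = \<alpha> and \<beta> = \<beta>, folded H assms(1), OF vH c cW] .
  have "osrc G ` set c = verts H"
  proof
    show "osrc G ` set c \<subseteq> verts H"
    proof
      fix y assume "y \<in> osrc G ` set c"
      then obtain c1 d c2 where "c = c1 @ d # c2" "y = osrc G d"
        by (auto simp: in_set_conv_decomp)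
      then show "y \<in> verts H" unfolding simps(3) using c cW by (auto simp: walk_append)
    qed
    show "verts H \<subseteq> osrc G ` set c"
      using circuit_absorbs_walk[OF c cW dist(2) _ _ planar_base v] unfolding simps(3) by blast
  qed
  moreover have "fst ` set c = cedges H"
  proof
    show "fst ` set c \<subseteq> cedges H"
      using walk_compact[OF cH] by (auto simp: compact_oedges_def)
    show "cedges H \<subseteq> fst ` set c"
    proof
      fix e assume "e \<in> cedges H"
      then have e: "e \<in> cedges G" "\<rho> (e, True) \<subseteq> W" "head G e \<in> verts H" using simps(4) by auto
      then have "(e, True) \<in> ingoing G (head G e)"
        by (intro compact_ingoing) (auto simp: compact_oedges_def otgt_def)
      then obtain d where "d \<in> set c" "(e, True) = d \<or> (e, True) = flip d"
        using circuit_contains_ingoing[OF c cW dist(2) _ planarH[OF e(3)]] e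
          \<open>osrc G ` set c = verts H\<close> by blast
      then show "e \<in> fst ` set c" by (metis fst_conv fst_flip image_eqI)
    qed
  qed
  ultimately show "full_circuit H v (p @ reverse_path q)"
    using cH dist by (simp add: full_circuit_def simps(1) c_def[symmetric])
  show "iedges H = {}"
  proof (rule equals0I)
    fix e assume "e \<in> iedges H"
    then have e: "e \<in> iedges G" "\<rho> (e, True) \<subseteq> W" using simps(5) by auto
    then have root: "\<rho> (e, True) \<in> roots G \<rho>" by (auto simp: roots_def oedges_def)
    \<comment> \<open>A root without an opposite is positive at every vertex, so it would be a plane
      root excluded by \<open>plane_opposite\<close>.\<close>
    then have "\<rho> (e, True) \<in> pos_roots G \<rho> v"
      using pos_or_opposite[OF base_vertex root] opposite_infinite[OF e(1)] pos_roots_subset by blast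
    then show False using plane_opposite e opposite_infinite by blast
  qed
qed

end

section \<open>Exchange of the first edge and induction on the distance\<close>

context matsumoto_graph
begin

text \<open>The final count says that either side of the polygon can be continued to a shortest path
  to \<open>w\<close>.\<close>

lemma rank_two_geodesics:
  assumes w: "w \<in> verts G"
    and a: "a \<in> compact_oedges G" "osrc G a = v" "\<rho> (flip a) \<notin> pos_roots G \<rho> w"
    and b: "b \<in> compact_oedges G" "osrc G b = v" "\<rho> (flip b) \<notin> pos_roots G \<rho> w"
    and "a \<noteq> b"
  shows "\<exists>p q u. walk G v (a # p) u \<and> walk G v (b # q) u \<and> length p = length q \<and>
    braid_equiv G \<rho> (v, a # p) (v, b # q) \<and>
    Suc (length p) + card (separating u w) = card (separating v w)"
proof -
  define W where "W = span (\<rho> (flip a) \<union> \<rho> (flip b))"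
  have v: "v \<in> verts G" using a compact_ends(1)[OF a(1)] by simp
  have ing: "flip a \<in> ingoing G v" "flip b \<in> ingoing G v" using a b by (simp_all add: compact_ingoing)
  have ne: "flip a \<noteq> flip b" using assms(8) by (metis flip_flip)
  have planar: "planar W v" using v ing ne unfolding planar_def W_def by blast
  have sub: "\<rho> (flip a) \<subseteq> W" "\<rho> (flip b) \<subseteq> W" by (auto simp: W_def intro: span_base)
  have neg: "\<gamma> \<notin> pos_roots G \<rho> w" if "\<gamma> \<in> pos_roots G \<rho> v" "\<gamma> \<subseteq> W" for \<gamma>
    using pos_root_planar_negative[OF planar ing ne sub w a(3) b(3) that] .
  \<comment> \<open>By \<open>neg\<close> the plane roots positive at \<open>v\<close> all separate
    \<open>v\<close> from \<open>w\<close>, so they are finite in number and have opposites that are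
    roots.\<close>
  interpret R: finite_rank_two G \<rho> v W
  proof
    show "planar W v" by (rule planar)
    have "{\<gamma> \<in> pos_roots G \<rho> v. \<gamma> \<subseteq> W} \<subseteq> separating v w" using neg by (auto simp: separating_def)
    then show "finite {\<gamma> \<in> pos_roots G \<rho> v. \<gamma> \<subseteq> W}"
      using finite_separating[OF v w] finite_subset by blast
    show "opposite_ray \<gamma> \<in> roots G \<rho>" if "\<gamma> \<in> pos_roots G \<rho> v" "\<gamma> \<subseteq> W" for \<gamma>
      using neg[OF that] pos_or_opposite[OF w, of \<gamma>] that pos_roots_subset by blast
  qed
  have start: "\<exists>p u. walk G v (c # p) u \<and> R.descending (c # p) \<and> R.remaining u = {}"
    if c: "c \<in> compact_oedges G" "osrc G c = v" "\<rho> (flip c) \<subseteq> W" for c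
  proof -
    have cN: "\<rho> (flip c) \<in> R.plane_roots"
      using c ingoing_pos_root[of "flip c" v] by (simp add: R.plane_roots_def compact_ingoing)
    then have "planar W (otgt G c)"
      using planar_step[OF planar c(1,2)] R.descending_root(1)[OF c(1)] by simp
    then obtain p u where "walk G (otgt G c) p u" "R.descending p" "R.remaining u = {}"
      using R.ex_descending_walk by blast
    then show ?thesis
      using c cN v by (intro exI[of _ p] exI[of _ u]) (auto simp: R.descending_def)
  qed
  obtain p u where p: "walk G v (a # p) u" "R.descending (a # p)" "R.remaining u = {}"
    using start[OF a(1,2) sub(1)] by blast
  obtain q u' where q': "walk G v (b # q) u'" "R.descending (b # q)" "R.remaining u' = {}"
    using start[OF b(1,2) sub(2)] by blast
  have "u' = u" using R.descending_end_unique[OF q' p] .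
  with q' have q: "walk G v (b # q) u" "R.descending (b # q)" by simp_all
  have len: "length (a # p) = card R.plane_roots" "length (b # q) = card R.plane_roots"
    using R.descending_walk(1)[OF p(1,2)] R.descending_walk(1)[OF q] p(3)
    by (simp_all add: R.remaining_base)
  define H where "H = rank_two_subgraph G \<rho> v (\<rho> (flip a)) (\<rho> (flip b))"
  have circuit: "full_circuit H v ((a # p) @ reverse_path (b # q))" and "iedges H = {}"
    using R.rank_two_full_circuit[OF W_def H_def p(1,2) _ q] assms(8) by simp_all
  then have "polygon (2 * card R.plane_roots) H"
    using len by (auto simp: polygon_def reverse_path_def intro!: exI[of _ v]
      exI[of _ "(a # p) @ reverse_path (b # q)"])
  moreover have "\<rho> (flip a) \<noteq> \<rho> (flip b)" using ingoing_root_inj[OF v ing] ne by blast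
  ultimately have braid: "braid_equiv G \<rho> (v, a # p) (v, b # q)"
    using braid_equiv.polygon[OF v _ _ _ H_def _ len circuit] ing by (simp add: basis_at_def)
  \<comment> \<open>Between \<open>v\<close> and \<open>u\<close> every plane root acquires the sign
    it has at \<open>w\<close>, and no other root changes.\<close>
  have "separating v w = R.plane_roots \<union> separating u w"
  proof -
    have out: "\<gamma> \<in> pos_roots G \<rho> u \<longleftrightarrow> \<gamma> \<in> pos_roots G \<rho> v" if "\<not> \<gamma> \<subseteq> W" for \<gamma>
      using R.descending_walk(2)[OF p(1,2)] that by blast
    have plane: "\<gamma> \<in> pos_roots G \<rho> w" if g: "\<gamma> \<in> pos_roots G \<rho> u" "\<gamma> \<subseteq> W" for \<gamma>
    proof -
      have root: "\<gamma> \<in> roots G \<rho>" using g(1) pos_roots_subset by blast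
      have "\<gamma> \<notin> pos_roots G \<rho> v"
        using g p(3) by (auto simp: R.remaining_def R.plane_roots_def)
      then have "opposite_ray \<gamma> \<notin> pos_roots G \<rho> w"
        using pos_or_opposite[OF v root] neg[of "opposite_ray \<gamma>"] g(2)
          opposite_subset_subspace[OF planar_subspace[OF planar]] by simp
      then show ?thesis using pos_or_opposite[OF w root] by blast
    qed
    show ?thesis
      using out plane neg unfolding separating_def R.plane_roots_def by blast
  qed
  moreover have "R.plane_roots \<inter> separating u w = {}"
    using p(3) by (auto simp: R.remaining_def separating_def)
  moreover have "finite R.plane_roots" using R.finite_remaining[of v] by (simp add: R.remaining_base)
  moreover have "finite (separating u w)" using finite_separating walk_verts[OF p(1)] w by blast
  ultimately have "card (separating v w) = card R.plane_roots + card (separating u w)"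
    by (simp add: card_Un_disjoint)
  then show ?thesis using p(1) q(1) len braid by (intro exI[of _ p] exI[of _ q] exI[of _ u]) simp
qed

lemma braid_equiv_append:
  assumes "braid_equiv G \<rho> (u, p) (u, p')" "walk G u p x" "walk G u p' x"
    and "braid_equiv G \<rho> (x, q) (x, q')"
  shows "braid_equiv G \<rho> (u, p @ q) (u, p' @ q')"
  using braid_equiv.concat[OF assms(1,4)] walk_path_end[OF assms(2)] walk_path_end[OF assms(3)]
  by (simp add: concat_path_def)

lemma shortest_paths_braid_equiv:
  "shortest_path G v p w \<Longrightarrow> shortest_path G v q w \<Longrightarrow> braid_equiv G \<rho> (v, p) (v, q)"
proof (induction "length p" arbitrary: v p q)
  case 0
  then have "p = []" "q = []" by (auto simp: shortest_path_iff)
  then show ?case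
    using 0 by (auto simp: shortest_path_iff intro!: braid_equiv.refl walk_in_paths)
next
  case (Suc n)
  then have "length q = Suc n" by (simp add: shortest_path_iff)
  then obtain a p' b q' where pq: "p = a # p'" "q = b # q'" "length p' = n" "length q' = n"
    using Suc.hyps(2) by (metis length_Suc_conv)
  note sp = Suc.prems[unfolded pq]
  have a: "a \<in> compact_oedges G" "osrc G a = v" and b: "b \<in> compact_oedges G" "osrc G b = v"
    and w: "w \<in> verts G" and lenv: "card (separating v w) = Suc n"
    using sp walk_verts[of G v "a # p'" w] pq(3) by (simp_all add: shortest_path_iff)
  have step: "braid_equiv G \<rho> (v, c # r) (v, c # s)"
    if "c \<in> compact_oedges G" "osrc G c = v" "length r = n"
      "shortest_path G (otgt G c) r w" "shortest_path G (otgt G c) s w" for c r s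
  proof -
    have c: "walk G v [c] (otgt G c)" using walk_single[OF that(1)] that(2) by simp
    then have "braid_equiv G \<rho> (v, [c]) (v, [c])" by (intro braid_equiv.refl walk_in_paths)
    moreover have "braid_equiv G \<rho> (otgt G c, r) (otgt G c, s)"
      using Suc.hyps(1) that(3-5) by simp
    ultimately show ?thesis using braid_equiv_append[OF _ c c] by fastforce
  qed
  show ?case
  proof (cases "a = b")
    case True
    then show ?thesis
      using step[OF a pq(3)] shortest_path_Cons(2)[OF sp(1)] shortest_path_Cons(2)[OF sp(2)] pq by simp
  next
    case False
    obtain r s u where rs: "walk G v (a # r) u" "walk G v (b # s) u" "length r = length s"
      "braid_equiv G \<rho> (v, a # r) (v, b # s)"
      "Suc (length r) + card (separating u w) = card (separating v w)"
      using rank_two_geodesics[OF w a shortest_path_Cons(1)[OF sp(1)] b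
        shortest_path_Cons(1)[OF sp(2)] False] by blast
    obtain t where t: "walk G u t w" "length t = card (separating u w)"
      using ex_walk_separating walk_verts[OF rs(1)] w by blast
    \<comment> \<open>Both detours use the same tail \<open>t\<close>, so the polygon relation
      extends to them by concatenation, and each shares its first edge with one of the given
      paths.\<close>
    have "shortest_path G v (a # r @ t) w" "shortest_path G v (b # s @ t) w"
      using rs t lenv by (auto simp: shortest_path_iff walk_append)
    then have "braid_equiv G \<rho> (v, a # p') (v, a # r @ t)"
      "braid_equiv G \<rho> (v, b # q') (v, b # s @ t)"
      using step[OF a pq(3)] step[OF b pq(4)] sp[THEN shortest_path_Cons(2)]
        shortest_path_Cons(2) by blast+
    moreover have "braid_equiv G \<rho> (v, (a # r) @ t) (v, (b # s) @ t)"
      by (rule braid_equiv_append[OF rs(4,1,2)]) (rule braid_equiv.refl[OF walk_in_paths[OF t(1)]])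
    ultimately show ?thesis
      unfolding pq using braid_equiv.trans braid_equiv.sym by (metis append_Cons)
  qed
qed

end

theorem theorem2p5p2:
  fixes G :: "('v, 'e) graph"
    and \<rho> :: "'e oedge \<Rightarrow> 'a::real_vector set"
    and v v' :: 'v
    and p q :: "'e oedge list"
  assumes "matsumoto_graph G \<rho>"
    and "v \<in> verts G" and "v' \<in> verts G"
    and "shortest_path G v p v'" and "shortest_path G v q v'"
  shows "braid_equiv G \<rho> (v, p) (v, q)"
  using matsumoto_graph.shortest_paths_braid_equiv[OF assms(1,4,5)] .

end
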